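(* Let $d\ge 1$, $s\in(0,1)$, $h>0$, and let $X\subset (h\mathbb{Z})^d$ be a finite set of cardinality $M\in\mathbb{N}$. Then there exists a non-zero function $u\in \ell_s$ on $(h\mathbb{Z})^d$ such that $u_j=0$ and $(-\Delta_{\mathrm d})^s u_j=0$ for all $j\in\mathbb{Z}^d$ with $hj\in X$.
   Context: Here $(h\mathbb{Z})^d=\{hj: j\in\mathbb{Z}^d\}$, and for $u:(h\mathbb{Z})^d\to\mathbb{R}$ we write $u_j:=u(hj)$. The space $\ell_s$ consists of all $u:(h\mathbb{Z})^d\to\mathbb{R}$ with $\sum_{m\in\mathbb{Z}^d}\frac{|u_m|}{(1+|m|)^{d+2s}}<\infty$. For $s\in(0,1)$ the fractional discrete Laplacian is $$(-\Delta_{\mathrm d})^s u_j=\sum_{m\in\mathbb{Z}^d,\,m\ne j}(u_j-u_m)K_s^h(j-m),\qquad K_s^h(m)=\frac{1}{h^{2s}|\Gamma(-s)|}\int_0^\infty e^{-2dt}\prod_{i=1}^d I_{m_i}(2t)\,\frac{dt}{t^{1+s}}\quad (m\neq 0),$$ with $K_s^h(0)=0$, where $I_k$ is the modified Bessel function of the first kind of order $k\in\mathbb{Z}$ (so $I_{-k}=I_k$). *)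

theory Defs
  imports "HOL-Analysis.Analysis"
begin

(* Points of Z^d are represented by the type int^'d, with d = CARD('d) >= 1.
   The point hj of the mesh (hZ)^d is gridpt h j. *)

definition gridpt :: "real \<Rightarrow> int ^ 'd \<Rightarrow> real ^ 'd" where
  "gridpt h j = (\<chi> i. h * of_int (j $ i))"

definition mesh :: "real \<Rightarrow> (real ^ 'd) set" where
  "mesh h = range (gridpt h)"

(* Mesh functions u : (hZ)^d -> R are represented by functions on real^'d, of which only
   the values on mesh h are ever used; "meshval h u j" is the number u_j = u(hj). *)

definition meshval :: "real \<Rightarrow> (real ^ 'd \<Rightarrow> real) \<Rightarrow> int ^ 'd \<Rightarrow> real" where
  "meshval h u j = u (gridpt h j)"

(* gridpt 1 m is m itself as a real vector, so norm (gridpt 1 m) is the Euclidean length |m|. *)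

definition ell :: "real \<Rightarrow> real \<Rightarrow> (real ^ 'd \<Rightarrow> real) set" where
  "ell h s = {u. (\<lambda>m :: int ^ 'd. \<bar>meshval h u m\<bar> /
                   (1 + norm (gridpt 1 m)) powr (real CARD('d) + 2 * s)) summable_on UNIV}"

(* Modified Bessel function of the first kind of integer order: the power series for order
   k >= 0, and I_k = I_(-k) for k < 0. *)

definition bessel_I :: "int \<Rightarrow> real \<Rightarrow> real" where
  "bessel_I k x =
     (\<Sum>n. (x / 2) ^ (2 * n + nat \<bar>k\<bar>) / (fact n * fact (n + nat \<bar>k\<bar>)))"

definition frac_kernel :: "real \<Rightarrow> real \<Rightarrow> int ^ 'd \<Rightarrow> real" where
  "frac_kernel h s m =
     (if m = 0 then 0
      else 1 / (h powr (2 * s) * \<bar>Gamma (- s)\<bar>) *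
        (LBINT t:{0<..}. exp (- 2 * real CARD('d) * t) *
           (\<Prod>i\<in>UNIV. bessel_I (m $ i) (2 * t)) / t powr (1 + s)))"

(* For s in (0,1) and u in ell h s the sum converges absolutely, because the kernel decays
   like |m| powr -(d + 2s); the default value of infsum plays no role there. *)

definition frac_laplacian :: "real \<Rightarrow> real \<Rightarrow> (real ^ 'd \<Rightarrow> real) \<Rightarrow> int ^ 'd \<Rightarrow> real" where
  "frac_laplacian h s u j =
     (\<Sum>\<^sub>\<infinity>m\<in>UNIV - {j}. (meshval h u j - meshval h u m) * frac_kernel h s (j - m))"

end

theory Submission
  imports Defs
begin

text \<open>
  The function \<open>u\<close> can be taken with finite support, and then only the linearity of the
  operator matters. Choose more than \<open>M\<close> lattice points outside \<open>X\<close> and let \<open>u\<close> be supported on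
  them, with unknown values. Membership in the weighted \<open>\<ell>\<^sup>1\<close> space and vanishing on \<open>X\<close>
  are then automatic. At a point of \<open>X\<close> the fractional Laplacian is a finite linear combination
  of the unknown values, so there are \<open>M\<close> homogeneous linear equations in more than \<open>M\<close>
  unknowns, and such a system has a nontrivial solution (\<open>underdetermined_system_solvable\<close>).
  The obstruction to unique continuation is thus a count of dimensions: the operator is linear,
  and the lattice, unlike \<open>X\<close>, is infinite.
\<close>

text \<open>Gaussian elimination: each equation either is void on the index set or eliminates one
  unknown, so induction on the equations loses at most one unknown at every step.\<close>

lemma underdetermined_system_solvable:
  fixes A :: "'a \<Rightarrow> 'b \<Rightarrow> 'c :: field"
  assumes "finite J" "finite S" "card J < card S"
  shows "\<exists>c. (\<exists>m\<in>S. c m \<noteq> 0) \<and> (\<forall>j\<in>J. (\<Sum>m\<in>S. c m * A j m) = 0)"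
  using assms
proof (induction J arbitrary: S A rule: finite_induct)
  case empty
  then obtain p where "p \<in> S" by fastforce
  then show ?case by (intro exI[of _ "\<lambda>_. 1"]) auto
next
  case (insert j J)
  show ?case
  proof (cases "\<forall>m\<in>S. A j m = 0")
    case True
    have "card J < card S" using insert.hyps insert.prems by simp
    then obtain c where "\<exists>m\<in>S. c m \<noteq> 0" "\<forall>i\<in>J. (\<Sum>m\<in>S. c m * A i m) = 0"
      using insert.IH[OF insert.prems(1)] by blast
    with True show ?thesis by auto
  next
    case False
    then obtain p where p: "p \<in> S" "A j p \<noteq> 0" by blast
    let ?T = "S - {p}"
    \<comment> \<open>Row \<open>i\<close> minus the multiple of row \<open>j\<close> that cancels its entry in the pivot column \<open>p\<close>.\<close>
    define B where "B i m = A i m - A i p / A j p * A j m" for i m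
    have "card J < card ?T" "finite ?T" using insert.hyps insert.prems p by auto
    then obtain c where c: "\<exists>m\<in>?T. c m \<noteq> 0" "\<forall>i\<in>J. (\<Sum>m\<in>?T. c m * B i m) = 0"
      using insert.IH by blast
    \<comment> \<open>The pivot unknown is the one that row \<open>j\<close> prescribes.\<close>
    define e where "e = c(p := - (\<Sum>m\<in>?T. c m * A j m) / A j p)"
    have split: "(\<Sum>m\<in>S. e m * A i m) =
        (\<Sum>m\<in>?T. c m * A i m) - (\<Sum>m\<in>?T. c m * A j m) / A j p * A i p" for i
    proof -
      have "(\<Sum>m\<in>?T. e m * A i m) = (\<Sum>m\<in>?T. c m * A i m)"
        by (rule sum.cong) (auto simp: e_def)
      then show ?thesis
        using p insert.prems(1) by (simp add: sum.remove[of S p] e_def)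
    qed
    have "(\<Sum>m\<in>S. e m * A i m) = (\<Sum>m\<in>?T. c m * B i m)" for i
    proof -
      have "(\<Sum>m\<in>?T. c m * B i m) =
          (\<Sum>m\<in>?T. c m * A i m - (A i p / A j p) * (c m * A j m))"
        by (simp add: B_def right_diff_distrib mult_ac)
      then show ?thesis
        unfolding split sum_subtractf sum_distrib_left[symmetric] by (simp add: mult_ac)
    qed
    then have "\<forall>i\<in>J. (\<Sum>m\<in>S. e m * A i m) = 0" using c(2) by simp
    moreover have "(\<Sum>m\<in>S. e m * A j m) = 0" using p by (simp add: split)
    moreover have "\<exists>m\<in>S. e m \<noteq> 0" using c(1) by (auto simp: e_def)
    ultimately show ?thesis by blast
  qed
qed

lemma inj_gridpt: "h \<noteq> 0 \<Longrightarrow> inj (gridpt h)"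
  by (auto simp: inj_def gridpt_def vec_eq_iff)

lemma infinite_lattice: "infinite (UNIV :: (int ^ 'd) set)"
proof -
  have "inj (\<lambda>n. (\<chi> i. n) :: int ^ 'd)" by (auto simp: inj_def vec_eq_iff)
  then have "infinite (range (\<lambda>n. (\<chi> i. n) :: int ^ 'd))"
    by (simp add: finite_image_iff)
  then show ?thesis by (rule infinite_super[OF subset_UNIV])
qed

lemma ell_if_finite_support:
  assumes "finite S" "\<And>m. m \<notin> S \<Longrightarrow> meshval h u m = 0"
  shows "u \<in> ell h s"
  unfolding ell_def mem_Collect_eq
  by (intro finite_nonzero_values_imp_summable_on finite_subset[OF _ assms(1)])
    (use assms(2) in auto)

lemma frac_laplacian_if_finite_support:
  assumes "finite S" "\<And>m. m \<notin> S \<Longrightarrow> meshval h u m = 0" "j \<notin> S"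
  shows "frac_laplacian h s u j = - (\<Sum>m\<in>S. meshval h u m * frac_kernel h s (j - m))"
proof -
  have "frac_laplacian h s u j =
      (\<Sum>\<^sub>\<infinity>m\<in>S. (meshval h u j - meshval h u m) * frac_kernel h s (j - m))"
    unfolding frac_laplacian_def using assms by (intro infsum_cong_neutral) auto
  also have "\<dots> = (\<Sum>m\<in>S. - (meshval h u m * frac_kernel h s (j - m)))"
    using assms by simp
  finally show ?thesis by (simp add: sum_negf)
qed

theorem theorem2:
  fixes s h :: real and X :: "(real ^ 'd) set" and M :: nat
  assumes "0 < s" "s < 1" "h > 0"
    and "X \<subseteq> mesh h" "finite X" "card X = M"
  shows "\<exists>u :: real ^ 'd \<Rightarrow> real.
           u \<in> ell h s \<and> (\<exists>x\<in>mesh h. u x \<noteq> 0) \<and>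
           (\<forall>j :: int ^ 'd. gridpt h j \<in> X \<longrightarrow>
              meshval h u j = 0 \<and> frac_laplacian h s u j = 0)"
proof -
  have inj: "inj (gridpt h :: int ^ 'd \<Rightarrow> real ^ 'd)" using assms by (simp add: inj_gridpt)
  define J :: "(int ^ 'd) set" where "J = gridpt h -` X"
  have "finite J" unfolding J_def using assms inj by (simp add: finite_vimageI)
  then have "infinite (- J)" using infinite_lattice by (simp add: Compl_eq_Diff_UNIV)
  then obtain S where S: "S \<subseteq> - J" "card S = Suc (card J)" "finite S"
    using infinite_arbitrarily_large by blast
  obtain c where c: "\<exists>m\<in>S. c m \<noteq> 0" "\<forall>j\<in>J. (\<Sum>m\<in>S. c m * frac_kernel h s (j - m)) = 0"
    using underdetermined_system_solvable[OF \<open>finite J\<close> \<open>finite S\<close>,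
        of "\<lambda>j m. frac_kernel h s (j - m)"] S by auto
  define u :: "real ^ 'd \<Rightarrow> real"
    where "u x = (if x \<in> gridpt h ` S then c (inv (gridpt h) x) else 0)" for x
  have u: "meshval h u m = (if m \<in> S then c m else 0)" for m
    using inj by (auto simp: meshval_def u_def inj_image_mem_iff)
  have "u \<in> ell h s" using S u by (intro ell_if_finite_support[of S]) auto
  moreover have "\<exists>x\<in>mesh h. u x \<noteq> 0"
    using c(1) u by (metis meshval_def mesh_def rangeI)
  moreover have "meshval h u j = 0 \<and> frac_laplacian h s u j = 0" if "gridpt h j \<in> X" for j
  proof -
    have j: "j \<in> J" "j \<notin> S" using that S by (auto simp: J_def)
    have "frac_laplacian h s u j = - (\<Sum>m\<in>S. meshval h u m * frac_kernel h s (j - m))"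
      using S u j by (intro frac_laplacian_if_finite_support) auto
    then show ?thesis using c(2) j u by simp
  qed
  ultimately show ?thesis by blast
qed

end
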